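(* Let $N\geq3$ and let $U=\frac{1}{N}(2J_N-NI_N)\in O(N)$, where $J_N$ is the all-ones matrix and $I_N$ is the identity matrix. Assume $B\in M_N(\mathbb R)$ is symmetric and $UB=\lambda B$ for some $\lambda\in\mathbb R$. Then $$\Phi(U,B)=\lambda\cdot\frac{N-4}{2}\left[\mathrm{Tr}(B^2)+\frac{\lambda N}{N-2}\sum_iB_{ii}^2\right].$$ In particular, $K_N=\sqrt N\,U$ is not a complex almost Hadamard matrix for $N\neq4$, because of the following two facts. (1) For $B=J_N$ one has $\Phi(U,B)=\frac{N^2(N-1)(N-4)}{2(N-2)}$, which is negative at $N=3$. (2) For any nonzero symmetric $B\in M_N(\mathbb R)$ with $BJ_N=0$ and all diagonal entries zero, one has $\Phi(U,B)=(2-\frac N2)\mathrm{Tr}(B^2)$, which is negative for $N\geq5$.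
   Context: Let $U\in U(N)$ have all entries nonzero. Define $S_{ij}=U_{ij}/|U_{ij}|$ and $X=S^*U$. For a hermitian matrix $B\in M_N(\mathbb C)$ define $$\Phi(U,B)=\mathrm{Tr}(XB^2)-\sum_{i,j}\frac{\mathrm{Re}\left[(UB)_{ij}\overline{S_{ij}}\right]^2}{|U_{ij}|}.$$ A matrix $H\in M_N(\mathbb C)$ is complex almost Hadamard if $H/\sqrt N$ is unitary and is a local maximizer of $V\mapsto\sum_{i,j}|V_{ij}|$ on $U(N)$. *)

theory Defs
  imports "HOL-Analysis.Analysis"
begin

definition conj_transpose :: "complex^'n^'m \<Rightarrow> complex^'m^'n" where
  "conj_transpose A = (\<chi> i j. cnj (A $ j $ i))"

definition unitary_group :: "(complex^'n^'n) set" where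
  "unitary_group = {V. conj_transpose V ** V = mat 1 \<and> V ** conj_transpose V = mat 1}"

definition phase_matrix :: "complex^'n^'n \<Rightarrow> complex^'n^'n" where
  "phase_matrix U = (\<chi> i j. U $ i $ j / of_real (cmod (U $ i $ j)))"

text \<open>Complex-valued, because the trace of \<open>X B\<^sup>2\<close> with \<open>X = S\<^sup>* U\<close> need not be real for
  an arbitrary unitary \<open>U\<close>. The definition is meaningful for \<open>U\<close> with all entries nonzero and
  \<open>B\<close> hermitian.\<close>

definition Phi :: "complex^'n^'n \<Rightarrow> complex^'n^'n \<Rightarrow> complex" where
  "Phi U B =
     trace ((conj_transpose (phase_matrix U) ** U) ** (B ** B))
     - of_real (\<Sum>i\<in>UNIV. \<Sum>j\<in>UNIV.
         (Re ((U ** B) $ i $ j * cnj (phase_matrix U $ i $ j)))\<^sup>2 / cmod (U $ i $ j))"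

definition one_norm :: "complex^'n^'n \<Rightarrow> real" where
  "one_norm V = (\<Sum>i\<in>UNIV. \<Sum>j\<in>UNIV. cmod (V $ i $ j))"

definition complex_almost_hadamard :: "complex^'n^'n \<Rightarrow> bool" where
  "complex_almost_hadamard H \<longleftrightarrow>
     (let U = (1 / sqrt (real CARD('n))) *\<^sub>R H in
        U \<in> unitary_group \<and>
        (\<forall>\<^sub>F V in at U within unitary_group. one_norm V \<le> one_norm U))"

definition all_ones :: "real^'n^'n" where
  "all_ones = (\<chi> i j. 1)"

end

theory Submission
  imports Defs
begin

text \<open>The matrix \<open>U = (2/N) J - I\<close> is an involution with sign matrix \<open>S = J - 2 I\<close>, so
  \<open>X = S\<^sup>* U = (1 - 4/N) J + 2 I\<close>. If \<open>U B = \<lambda> B\<close> with \<open>B \<noteq> 0\<close>, then \<open>\<lambda>\<^sup>2 = 1\<close> and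
  \<open>J B = (N/2) (\<lambda> + 1) B\<close>, which turns \<open>Tr (X B\<^sup>2)\<close> into a multiple of \<open>Tr (B\<^sup>2)\<close>; the
  correction sum takes only the two weights \<open>1 / |U\<^sub>i\<^sub>j|\<close> on and off the diagonal.

  That \<open>U\<close> is not a local maximizer for \<open>N \<noteq> 4\<close> is shown by a single explicit path, without
  passing through the second derivative \<open>\<Phi>\<close>: let \<open>p = (e\<^sub>a - e\<^sub>b) / \<surd>2\<close>, for which \<open>U p = - p\<close>,
  and multiply \<open>U\<close> by the unitary rotating \<open>p\<close> by a phase \<open>w\<close>. Only four entries change, and
  with \<open>x = 2/N\<close> the 1-norm changes by twice
  \<open>|1 - x + (w - 1)/2| + |x + (w - 1)/2| - 1\<close>, which is positive for \<open>w\<close> near \<open>1\<close>, \<open>w \<noteq> 1\<close>,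
  as soon as \<open>x \<noteq> 1/2\<close>.\<close>

section \<open>Real matrices inside the complex ones\<close>

lemma conj_transpose_map_matrix_of_real:
  "conj_transpose (map_matrix complex_of_real A) = map_matrix complex_of_real (transpose A)"
  by (simp add: vec_eq_iff conj_transpose_def transpose_def)

lemma map_matrix_of_real_mult:
  "map_matrix complex_of_real A ** map_matrix complex_of_real B = map_matrix complex_of_real (A ** B)"
  by (simp add: vec_eq_iff matrix_matrix_mult_def)

lemma trace_map_matrix_of_real:
  "trace (map_matrix complex_of_real A) = complex_of_real (trace A)"
  by (simp add: trace_def)

lemma phase_matrix_map_matrix_of_real:
  "phase_matrix (map_matrix complex_of_real A) = map_matrix complex_of_real (map_matrix sgn A)"
  by (simp add: vec_eq_iff phase_matrix_def sgn_real_def)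

lemma Phi_map_matrix_of_real:
  "Phi (map_matrix complex_of_real A) (map_matrix complex_of_real B) =
     complex_of_real (trace ((transpose (map_matrix sgn A) ** A) ** (B ** B))
       - (\<Sum>i\<in>UNIV. \<Sum>j\<in>UNIV. ((A ** B) $ i $ j)\<^sup>2 / \<bar>A $ i $ j\<bar>))"
proof -
  \<comment> \<open>A nonzero entry has a real phase of square 1, which drops out of the square. At
    a zero entry both quotients are 0 by the convention for division by zero.\<close>
  have "(Re (map_matrix complex_of_real (A ** B) $ i $ j * cnj (map_matrix complex_of_real (map_matrix sgn A) $ i $ j)))\<^sup>2
      / cmod (map_matrix complex_of_real A $ i $ j) = ((A ** B) $ i $ j)\<^sup>2 / \<bar>A $ i $ j\<bar>"
    for i j
    by (cases "A $ i $ j = 0") (auto simp: power_mult_distrib sgn_if)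
  then show ?thesis
    unfolding Phi_def phase_matrix_map_matrix_of_real conj_transpose_map_matrix_of_real
      map_matrix_of_real_mult trace_map_matrix_of_real
    by (simp only: of_real_diff)
qed

text \<open>Symmetry turns the trace into the squared Frobenius norm; this serves both the
  correction sum and the positivity of the trace for \<open>B \<noteq> 0\<close>.\<close>

lemma trace_square_symmetric:
  fixes B :: "real^'n^'n"
  assumes "transpose B = B"
  shows "trace (B ** B) = (\<Sum>i\<in>UNIV. \<Sum>j\<in>UNIV. (B $ i $ j)\<^sup>2)"
proof -
  have "B $ i $ j = B $ j $ i" for i j
    using arg_cong[OF assms, of "\<lambda>M. M $ j $ i"] by (simp add: transpose_def)
  then show ?thesis
    by (simp add: trace_def matrix_matrix_mult_def power2_eq_square)
qed

section \<open>The reflection \<open>(2/N) J - I\<close>\<close>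

text \<open>This is \<open>2 P - I\<close> with \<open>P\<close> the orthogonal projection onto
  constant vectors: constants are fixed, vectors of sum zero are negated.\<close>

definition mean_reflection :: "real^'n^'n" where
  "mean_reflection = (\<chi> i j. 2 / real CARD('n) - (if i = j then 1 else 0))"

lemma mean_reflection_eq:
  "(1 / real CARD('n)) *\<^sub>R (2 *\<^sub>R all_ones - real CARD('n) *\<^sub>R mat 1) = (mean_reflection :: real^'n^'n)"
  by (simp add: vec_eq_iff mean_reflection_def all_ones_def mat_def field_simps)

lemma transpose_mean_reflection: "transpose mean_reflection = mean_reflection"
  by (simp add: vec_eq_iff mean_reflection_def transpose_def)

lemma mean_reflection_mult_nth:
  "((mean_reflection :: real^'n^'n) ** B) $ i $ j = 2 / real CARD('n) * (\<Sum>k\<in>UNIV. B $ k $ j) - B $ i $ j"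
proof -
  have "(\<Sum>k\<in>UNIV. (if i = k then 1 else 0) * B $ k $ j) = B $ i $ j"
    by (simp add: if_distrib[of "\<lambda>x. x * _"] cong: if_cong)
  then show ?thesis
    by (simp add: matrix_matrix_mult_def mean_reflection_def left_diff_distrib sum_subtractf sum_distrib_left)
qed

lemma mean_reflection_involution: "mean_reflection ** mean_reflection = (mat 1 :: real^'n^'n)"
proof -
  have "(\<Sum>k\<in>UNIV. (mean_reflection :: real^'n^'n) $ k $ j) = 1" for j
    by (simp add: mean_reflection_def sum_subtractf)
  then show ?thesis
    by (simp add: vec_eq_iff mean_reflection_mult_nth) (simp add: mean_reflection_def mat_def)
qed

lemma orthogonal_mean_reflection: "orthogonal_matrix mean_reflection"
  by (simp add: orthogonal_matrix_def transpose_mean_reflection mean_reflection_involution)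

section \<open>Evaluating \<open>Phi\<close> at the reflection\<close>

lemma trace_sgn_mean_reflection_mult:
  fixes C :: "real^'n^'n"
  assumes "CARD('n) \<ge> 3"
  shows "trace ((transpose (map_matrix sgn mean_reflection) ** mean_reflection) ** C) =
    (real CARD('n) - 4) / real CARD('n) * (\<Sum>i\<in>UNIV. \<Sum>k\<in>UNIV. C $ k $ i) + 2 * trace C"
proof -
  let ?N = "real CARD('n)" and ?K = "mean_reflection :: real^'n^'n"
  \<comment> \<open>\<open>N \<ge> 3\<close> makes the diagonal entries \<open>2/N - 1\<close>
    negative.\<close>
  have sgn: "sgn (?K $ i $ j) = 1 - 2 * (if i = j then 1 else 0)" for i j
    using assms by (auto simp: mean_reflection_def sgn_if field_simps)
  have col: "(\<Sum>k\<in>UNIV. ?K $ k $ j) = 1" for j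
    by (simp add: mean_reflection_def sum_subtractf)
  have X: "(transpose (map_matrix sgn ?K) ** ?K) $ i $ j = (?N - 4) / ?N + 2 * (if i = j then 1 else 0)" for i j
  proof -
    have "(transpose (map_matrix sgn ?K) ** ?K) $ i $ j
        = (\<Sum>k\<in>UNIV. ?K $ k $ j - 2 * (if i = k then ?K $ k $ j else 0))"
      by (auto simp: matrix_matrix_mult_def transpose_def sgn algebra_simps intro!: sum.cong)
    also have "\<dots> = 1 - 2 * ?K $ i $ j"
      by (simp add: sum_subtractf col flip: sum_distrib_left)
    also have "\<dots> = (?N - 4) / ?N + 2 * (if i = j then 1 else 0)"
      by (simp add: mean_reflection_def field_simps)
    finally show ?thesis .
  qed
  have "((transpose (map_matrix sgn ?K) ** ?K) ** C) $ i $ i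
      = (\<Sum>k\<in>UNIV. (?N - 4) / ?N * C $ k $ i + 2 * (if i = k then C $ k $ i else 0))" for i
    unfolding matrix_matrix_mult_def[of _ C]
    by (auto simp: X algebra_simps intro!: sum.cong)
  then have "trace ((transpose (map_matrix sgn ?K) ** ?K) ** C)
      = (\<Sum>i\<in>UNIV. (?N - 4) / ?N * (\<Sum>k\<in>UNIV. C $ k $ i) + 2 * C $ i $ i)"
    unfolding trace_def by (simp only: sum.distrib flip: sum_distrib_left) simp
  then show ?thesis
    by (simp only: trace_def sum.distrib flip: sum_distrib_left)
qed

lemma sum_square_div_abs_mean_reflection:
  fixes B :: "real^'n^'n"
  assumes "CARD('n) \<ge> 3"
  shows "(\<Sum>i\<in>UNIV. \<Sum>j\<in>UNIV. (B $ i $ j)\<^sup>2 / \<bar>(mean_reflection :: real^'n^'n) $ i $ j\<bar>) =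
    real CARD('n) / 2 * (\<Sum>i\<in>UNIV. \<Sum>j\<in>UNIV. (B $ i $ j)\<^sup>2)
    - real CARD('n) * (real CARD('n) - 4) / (2 * (real CARD('n) - 2)) * (\<Sum>i\<in>UNIV. (B $ i $ i)\<^sup>2)"
proof -
  let ?N = "real CARD('n)" and ?K = "mean_reflection :: real^'n^'n"
  have N: "?N \<ge> 3" using assms by simp
  \<comment> \<open>The weight is \<open>N/2\<close> off the diagonal and \<open>N/(N-2)\<close> on
    it; the coefficient of the indicator is their difference.\<close>
  have 1: "1 / \<bar>?K $ i $ j\<bar> = ?N / 2 - ?N * (?N - 4) / (2 * (?N - 2)) * (if i = j then 1 else 0)" for i j
  proof (cases "i = j")
    case True
    then have "\<bar>?K $ i $ j\<bar> = (?N - 2) / ?N"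
      using N by (simp add: mean_reflection_def abs_if field_simps)
    with True N show ?thesis
      unfolding \<open>\<bar>?K $ i $ j\<bar> = _\<close> by (simp add: divide_simps) (simp add: algebra_simps)
  qed (simp add: mean_reflection_def)
  have "(B $ i $ j)\<^sup>2 / \<bar>?K $ i $ j\<bar> = ?N / 2 * (B $ i $ j)\<^sup>2
      - ?N * (?N - 4) / (2 * (?N - 2)) * (if i = j then (B $ i $ j)\<^sup>2 else 0)" for i j
    using arg_cong[OF 1[of i j], of "\<lambda>x. (B $ i $ j)\<^sup>2 * x"]
    by (cases "i = j") (simp_all add: algebra_simps)
  then show ?thesis
    by (simp only: sum_subtractf flip: sum_distrib_left) simp
qed

lemma Phi_mean_reflection_eigen:
  fixes B :: "real^'n^'n"
  assumes card: "CARD('n) \<ge> 3" and sym: "transpose B = B"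
    and eig: "mean_reflection ** B = lam *\<^sub>R B"
  shows "Phi (map_matrix complex_of_real mean_reflection) (map_matrix complex_of_real B) =
    complex_of_real (lam * ((real CARD('n) - 4) / 2) * (trace (B ** B)
      + lam * real CARD('n) / (real CARD('n) - 2) * (\<Sum>i\<in>UNIV. (B $ i $ i)\<^sup>2)))"
proof (cases "B = 0")
  \<comment> \<open>Here \<open>lam\<close> is arbitrary, so \<open>lam^2 = 1\<close> cannot be
    derived; instead both sides vanish.\<close>
  case True
  then show ?thesis
    unfolding Phi_map_matrix_of_real by (simp add: trace_def matrix_matrix_mult_def)
next
  case False
  let ?N = "real CARD('n)" and ?K = "mean_reflection :: real^'n^'n"
  let ?T = "trace (B ** B)" and ?D = "\<Sum>i\<in>UNIV. (B $ i $ i)\<^sup>2"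
  have N: "?N \<ge> 3" using card by simp
  have "B = ?K ** (?K ** B)"
    by (simp add: matrix_mul_assoc mean_reflection_involution)
  also have "\<dots> = lam\<^sup>2 *\<^sub>R B"
    by (simp add: eig matrix_scalar_ac power2_eq_square flip: scalar_matrix_assoc)
  finally have "(1 - lam\<^sup>2) *\<^sub>R B = 0"
    by (simp add: scaleR_left_diff_distrib)
  with False have lam: "lam\<^sup>2 = 1" by simp
  \<comment> \<open>Entrywise, the eigenvalue equation ties a column sum to every entry of that
    column, so the row \<open>i\<close> can be chosen freely.\<close>
  have col: "(\<Sum>k\<in>UNIV. B $ k $ j) = ?N * (lam + 1) / 2 * B $ i $ j" for i j
    using arg_cong[OF eig, of "\<lambda>M. M $ i $ j"] N
    by (simp add: mean_reflection_mult_nth field_simps)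
  have "(\<Sum>k\<in>UNIV. (B ** B) $ k $ i) = ?N * (lam + 1) / 2 * (B ** B) $ i $ i" for i
  proof -
    have "(\<Sum>k\<in>UNIV. (B ** B) $ k $ i) = (\<Sum>l\<in>UNIV. (\<Sum>k\<in>UNIV. B $ k $ l) * B $ l $ i)"
      unfolding matrix_matrix_mult_def by (simp add: sum_distrib_right) (rule sum.swap)
    \<comment> \<open>Choosing row \<open>i\<close> in every column \<open>l\<close> rebuilds the
      product at position \<open>(i, i)\<close>.\<close>
    also have "\<dots> = ?N * (lam + 1) / 2 * (B ** B) $ i $ i"
      unfolding col[where i = i] matrix_matrix_mult_def
      by (simp add: sum_distrib_left mult.assoc)
    finally show ?thesis .
  qed
  then have tr: "(\<Sum>i\<in>UNIV. \<Sum>k\<in>UNIV. (B ** B) $ k $ i) = ?N * (lam + 1) / 2 * ?T"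
    unfolding trace_def by (simp only: sum_distrib_left)
  \<comment> \<open>As \<open>lam^2 = 1\<close>, the squared entries of \<open>?K ** B\<close> are
    those of \<open>B\<close>.\<close>
  have "(\<Sum>i\<in>UNIV. \<Sum>j\<in>UNIV. ((?K ** B) $ i $ j)\<^sup>2 / \<bar>?K $ i $ j\<bar>)
      = ?N / 2 * ?T - ?N * (?N - 4) / (2 * (?N - 2)) * ?D"
    using sum_square_div_abs_mean_reflection[OF card, of B] lam
    by (simp add: eig power_mult_distrib trace_square_symmetric[OF sym])
  moreover have "(?N - 4) / ?N * (?N * (lam + 1) / 2 * ?T) + 2 * ?T
      - (?N / 2 * ?T - ?N * (?N - 4) / (2 * (?N - 2)) * ?D)
    = lam * ((?N - 4) / 2) * (?T + lam * ?N / (?N - 2) * ?D)"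
  proof -
    \<comment> \<open>Naming the fraction leaves an identity that is linear in the remaining
      products once \<open>lam^2 = 1\<close> is used.\<close>
    define q where "q = ?N / (?N - 2) * ?D"
    have "(?N - 4) / ?N * (?N * (lam + 1) / 2 * ?T) = (?N - 4) * (lam + 1) / 2 * ?T"
      using N by simp
    moreover have "?N * (?N - 4) / (2 * (?N - 2)) * ?D = (?N - 4) / 2 * q"
      by (simp add: q_def)
    moreover have "lam * ((?N - 4) / 2) * (?T + lam * q) = lam * ((?N - 4) / 2) * ?T + lam\<^sup>2 * ((?N - 4) / 2 * q)"
      by (simp add: distrib_left power2_eq_square)
    moreover have "lam * ?N / (?N - 2) * ?D = lam * q"
      by (simp add: q_def)
    ultimately show ?thesis
      unfolding lam by (simp only:) argo
  qed
  ultimately show ?thesis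
    unfolding Phi_map_matrix_of_real trace_sgn_mean_reflection_mult[OF card] tr
    by (simp only:)
qed

text \<open>The columns are constant vectors, so this is the case of eigenvalue 1.\<close>

lemma Phi_mean_reflection_all_ones:
  assumes "CARD('n) \<ge> 3"
  shows "Phi (map_matrix complex_of_real mean_reflection)
      (map_matrix complex_of_real (all_ones :: real^'n^'n)) =
    complex_of_real ((real CARD('n))\<^sup>2 * (real CARD('n) - 1) * (real CARD('n) - 4)
      / (2 * (real CARD('n) - 2)))"
proof -
  let ?N = "real CARD('n)" and ?J = "all_ones :: real^'n^'n"
  have N: "?N \<ge> 3" using assms by simp
  have sym: "transpose ?J = ?J"
    by (simp add: vec_eq_iff transpose_def all_ones_def)
  have eig: "mean_reflection ** ?J = 1 *\<^sub>R ?J"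
    by (simp add: vec_eq_iff mean_reflection_mult_nth) (simp add: all_ones_def)
  have "trace (?J ** ?J) = ?N\<^sup>2"
    by (simp add: trace_def matrix_matrix_mult_def all_ones_def power2_eq_square)
  moreover have "(\<Sum>i\<in>UNIV. (?J $ i $ i)\<^sup>2) = ?N"
    by (simp add: all_ones_def)
  moreover have "1 * ((?N - 4) / 2) * (?N\<^sup>2 + 1 * ?N / (?N - 2) * ?N)
      = ?N\<^sup>2 * (?N - 1) * (?N - 4) / (2 * (?N - 2))"
    using N by (simp add: divide_simps) (simp add: algebra_simps power2_eq_square)
  ultimately show ?thesis
    using Phi_mean_reflection_eigen[OF assms sym eig] by (simp only:)
qed

text \<open>By symmetry, vanishing row sums give vanishing column sums, so the reflection negates
  every column: the case of eigenvalue -1 without the diagonal term.\<close>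

lemma Phi_mean_reflection_zero_diagonal:
  fixes B :: "real^'n^'n"
  assumes card: "CARD('n) \<ge> 3" and sym: "transpose B = B"
    and J: "B ** all_ones = (0 :: real^'n^'n)" and diag: "\<And>i. B $ i $ i = 0"
  shows "Phi (map_matrix complex_of_real mean_reflection) (map_matrix complex_of_real B) =
    complex_of_real ((2 - real CARD('n) / 2) * trace (B ** B))"
proof -
  have "(\<Sum>k\<in>UNIV. B $ k $ j) = (\<Sum>k\<in>UNIV. transpose B $ j $ k)" for j
    by (simp add: transpose_def)
  also have "\<dots> j = 0" for j
    using arg_cong[OF J, of "\<lambda>M. M $ j $ j"]
    by (simp add: sym matrix_matrix_mult_def all_ones_def)
  finally have "(\<Sum>k\<in>UNIV. B $ k $ j) = 0" for j .
  then have eig: "mean_reflection ** B = (-1) *\<^sub>R B"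
    by (simp add: vec_eq_iff mean_reflection_mult_nth)
  show ?thesis
    unfolding Phi_mean_reflection_eigen[OF card sym eig]
    by (simp add: diag algebra_simps diff_divide_distrib)
qed

section \<open>Failure of local maximality along a unitary path\<close>

text \<open>Strict increase does double duty: it contradicts maximality and keeps \<open>V t\<close>
  different from \<open>A\<close>, as the punctured neighbourhoods in the definition demand.\<close>

lemma one_norm_less_not_complex_almost_hadamard:
  fixes A :: "complex^'n^'n"
  assumes lim: "(V \<longlongrightarrow> A) F" and "F \<noteq> bot"
    and unitary: "\<And>t. V t \<in> unitary_group"
    and less: "\<forall>\<^sub>F t in F. one_norm A < one_norm (V t)"
  shows "\<not> complex_almost_hadamard (sqrt (real CARD('n)) *\<^sub>R A)"
proof
  assume "complex_almost_hadamard (sqrt (real CARD('n)) *\<^sub>R A)"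
  then have max: "\<forall>\<^sub>F W in at A within unitary_group. one_norm W \<le> one_norm A"
    by (simp add: complex_almost_hadamard_def)
  have "\<forall>\<^sub>F t in F. V t \<in> unitary_group \<and> V t \<noteq> A"
    using less by eventually_elim (use unitary in auto)
  with lim have "filterlim V (at A within unitary_group) F"
    by (auto simp: filterlim_at)
  from filterlim_iff[THEN iffD1, OF this, rule_format, OF max]
  have "\<forall>\<^sub>F t in F. one_norm (V t) \<le> one_norm A" .
  with less have "\<forall>\<^sub>F t in F. False"
    by eventually_elim simp
  with \<open>F \<noteq> bot\<close> show False by simp
qed

text \<open>For \<open>cmod w = 1\<close> this is \<open>mean_reflection\<close> times the unitary acting as \<open>w\<close> on
  \<open>e\<^sub>a - e\<^sub>b\<close>, an eigenvector of \<open>mean_reflection\<close> for \<open>-1\<close>, and as the identity on its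
  orthogonal complement.\<close>

definition twist :: "'n \<Rightarrow> 'n \<Rightarrow> complex \<Rightarrow> complex^'n^'n" where
  "twist a b w = (\<chi> i j. of_real (mean_reflection $ i $ j)
     - (w - 1) / 2 * of_real ((axis a 1 - axis b 1 :: real^'n) $ i * (axis a 1 - axis b 1 :: real^'n) $ j))"

lemma twist_1: "twist a b 1 = map_matrix complex_of_real mean_reflection"
  by (simp add: twist_def vec_eq_iff)

text \<open>With \<open>z = (w - 1)/2\<close> and \<open>d = e_a - e_b\<close>, the relations
  \<open>K d = - d\<close> and \<open>d . d = 2\<close> make the product with the adjoint
  \<open>I + (z + cnj z + 2 |z|^2) d d^T\<close>. The coefficient vanishes because
  \<open>|1 + 2 z| = |w| = 1\<close>.\<close>

lemma twist_unitary:
  fixes a b :: "'n::finite"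
  assumes "a \<noteq> b" and w: "cmod w = 1"
  shows "twist a b w \<in> unitary_group"
proof -
  let ?K = "mean_reflection :: real^'n^'n" and ?d = "axis a 1 - axis b 1 :: real^'n"
  define z where "z = (w - 1) / 2"
  have "w * cnj w = 1"
    using w complex_norm_square[of w] by simp
  then have z: "z + cnj z + 2 * (z * cnj z) = 0"
    by (simp add: z_def field_simps)
  have symK: "?K $ i $ j = ?K $ j $ i" for i j
    by (simp add: mean_reflection_def)
  have KK: "(\<Sum>k\<in>UNIV. ?K $ i $ k * ?K $ j $ k) = (if i = j then 1 else 0)" for i j
    using arg_cong[OF mean_reflection_involution, of "\<lambda>M. M $ i $ j"]
    by (subst symK[of j]) (simp add: matrix_matrix_mult_def mat_def)
  have "sum (($) ?d) UNIV = 0"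
    by (simp add: axis_def sum_subtractf)
  \<comment> \<open>The matrix with all columns equal to \<open>?d\<close> lets the entry formula
    for products act on a vector.\<close>
  then have Kd: "(\<Sum>k\<in>UNIV. ?K $ i $ k * ?d $ k) = - ?d $ i" for i
    using mean_reflection_mult_nth[of "\<chi> k _. ?d $ k" i i]
    by (simp add: matrix_matrix_mult_def)
  have dd: "(\<Sum>k\<in>UNIV. ?d $ k * ?d $ k) = 2"
  proof -
    have "?d $ k * ?d $ k = (if k = a then 1 else 0) + (if k = b then 1 else 0)" for k
      using \<open>a \<noteq> b\<close> by (simp add: axis_def)
    then show ?thesis by (simp only: sum.distrib) simp
  qed
  have "(twist a b w ** conj_transpose (twist a b w)) $ i $ j = (mat 1 :: complex^'n^'n) $ i $ j" for i j
  proof -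
    have "(twist a b w ** conj_transpose (twist a b w)) $ i $ j
      = (\<Sum>k\<in>UNIV. of_real (?K $ i $ k * ?K $ j $ k) - cnj z * of_real (?d $ j) * of_real (?K $ i $ k * ?d $ k)
        - z * of_real (?d $ i) * of_real (?K $ j $ k * ?d $ k)
        + z * cnj z * of_real (?d $ i * ?d $ j) * of_real (?d $ k * ?d $ k))"
      unfolding matrix_matrix_mult_def conj_transpose_def twist_def z_def[symmetric]
      by (simp add: algebra_simps del: vector_minus_component)
    also have "\<dots> = of_real (\<Sum>k\<in>UNIV. ?K $ i $ k * ?K $ j $ k)
        - cnj z * of_real (?d $ j) * of_real (\<Sum>k\<in>UNIV. ?K $ i $ k * ?d $ k)
        - z * of_real (?d $ i) * of_real (\<Sum>k\<in>UNIV. ?K $ j $ k * ?d $ k)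
        + z * cnj z * of_real (?d $ i * ?d $ j) * of_real (\<Sum>k\<in>UNIV. ?d $ k * ?d $ k)"
      by (simp only: sum.distrib sum_subtractf sum_distrib_left of_real_sum)
    also have "\<dots> = of_real (if i = j then 1 else 0)
        + (z + cnj z + 2 * (z * cnj z)) * of_real (?d $ i * ?d $ j)"
      unfolding KK Kd dd by (simp add: algebra_simps del: vector_minus_component)
    also have "\<dots> = (mat 1 :: complex^'n^'n) $ i $ j"
      by (simp add: z mat_def)
    finally show ?thesis .
  qed
  then have "twist a b w ** conj_transpose (twist a b w) = mat 1"
    by (simp add: vec_eq_iff)
  then show ?thesis
    by (simp add: unitary_group_def matrix_left_right_inverse)
qed

text \<open>The perturbation is a multiple of \<open>d d^T\<close> with
  \<open>d = e_a - e_b\<close>, so it touches only positions with both indices in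
  \<open>{a, b}\<close>: two diagonal and two off-diagonal ones, equal in pairs, hence the factor
  2.\<close>

lemma one_norm_twist:
  fixes a b :: "'n::finite"
  assumes "a \<noteq> b"
  shows "one_norm (twist a b w) = one_norm (twist a b 1)
    + 2 * (cmod (of_real (1 - 2 / real CARD('n)) + (w - 1) / 2)
         + cmod (of_real (2 / real CARD('n)) + (w - 1) / 2)
         - \<bar>1 - 2 / real CARD('n)\<bar> - 2 / real CARD('n))"
proof -
  let ?x = "2 / real CARD('n)"
  define f where "f i j = cmod (twist a b w $ i $ j) - cmod (twist a b 1 $ i $ j)" for i j
  have 0: "f i j = 0" if "i \<notin> {a, b} \<or> j \<notin> {a, b}" for i j
    using that by (auto simp: f_def twist_def axis_def)
  have diagonal: "f i i = cmod (of_real (1 - ?x) + (w - 1) / 2) - \<bar>1 - ?x\<bar>" if "i \<in> {a, b}" for i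
  proof -
    have "twist a b w $ i $ i = - (of_real (1 - ?x) + (w - 1) / 2)" "twist a b 1 $ i $ i = - of_real (1 - ?x)"
      using assms that by (auto simp: twist_def axis_def mean_reflection_def)
    then show ?thesis by (simp only: f_def norm_minus_cancel norm_of_real)
  qed
  have off_diagonal: "f i j = cmod (of_real ?x + (w - 1) / 2) - ?x"
    if "i \<in> {a, b}" "j \<in> {a, b}" "i \<noteq> j" for i j
  proof -
    have "twist a b w $ i $ j = of_real ?x + (w - 1) / 2" "twist a b 1 $ i $ j = of_real ?x"
      using assms that by (auto simp: twist_def axis_def mean_reflection_def field_simps)
    then show ?thesis by (simp only: f_def norm_of_real) simp
  qed
  have "one_norm (twist a b w) - one_norm (twist a b 1) = (\<Sum>i\<in>UNIV. \<Sum>j\<in>UNIV. f i j)"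
    by (simp add: one_norm_def f_def sum_subtractf)
  also have "\<dots> = (\<Sum>i\<in>{a, b}. \<Sum>j\<in>UNIV. f i j)"
    by (rule sum.mono_neutral_right) (auto simp: 0)
  also have "\<dots> = (\<Sum>i\<in>{a, b}. \<Sum>j\<in>{a, b}. f i j)"
    by (intro sum.cong refl sum.mono_neutral_right) (auto simp: 0)
  also have "\<dots> = f a a + f a b + f b a + f b b"
    using assms by simp
  also have "\<dots> = 2 * (cmod (of_real (1 - ?x) + (w - 1) / 2) + cmod (of_real ?x + (w - 1) / 2) - \<bar>1 - ?x\<bar> - ?x)"
    using diagonal[of a] diagonal[of b] off_diagonal[of a b] off_diagonal[of b a] assms by simp
  finally show ?thesis by simp
qed

text \<open>On the unit circle the squares of \<open>Re w\<close> and \<open>Im w\<close> add up to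
  1, which leaves an expression affine in \<open>Re w\<close>.\<close>

lemma cmod_add_half_diff_1_square:
  assumes "cmod w = 1"
  shows "(cmod (of_real r + (w - 1) / 2))\<^sup>2 = r\<^sup>2 + (1 - Re w) * (1/2 - r)"
proof -
  have "(Re w)\<^sup>2 + (Im w)\<^sup>2 = 1"
    using assms by (simp add: cmod_power2 flip: cmod_power2)
  moreover have "(cmod (of_real r + (w - 1) / 2))\<^sup>2 = (r + (Re w - 1) / 2)\<^sup>2 + (Im w / 2)\<^sup>2"
    by (simp add: cmod_power2)
  ultimately show ?thesis
    by (simp add: power2_eq_square field_simps)
qed

text \<open>If \<open>p\<close> and \<open>q\<close> are the two moduli and \<open>d = 1 - Re w\<close>, then
  \<open>(p + q)\<^sup>2 - 1 = 2 (p q - x (1 - x))\<close> and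
  \<open>(p q)\<^sup>2 - (x (1 - x))\<^sup>2 = d (2 - d) (1/2 - x)\<^sup>2\<close>. The excluded value \<open>x = 1/2\<close> is the case
  \<open>N = 4\<close> for \<open>x = 2/N\<close>.\<close>

lemma cmod_sum_gt_1:
  fixes x :: real
  assumes w: "cmod w = 1" "0 < Re w" "Re w < 1" and x: "0 < x" "x < 1" "x \<noteq> 1/2"
  shows "1 < cmod (of_real (1 - x) + (w - 1) / 2) + cmod (of_real x + (w - 1) / 2)"
proof -
  define d where "d = 1 - Re w"
  define p where "p = cmod (of_real (1 - x) + (w - 1) / 2)"
  define q where "q = cmod (of_real x + (w - 1) / 2)"
  have d: "0 < d" "d < 1" using w by (auto simp: d_def)
  have p: "p\<^sup>2 = (1 - x)\<^sup>2 + d * (1/2 - (1 - x))" and q: "q\<^sup>2 = x\<^sup>2 + d * (1/2 - x)"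
    unfolding p_def q_def d_def using cmod_add_half_diff_1_square[OF w(1)] by blast+
  have "(p * q)\<^sup>2 = (x * (1 - x))\<^sup>2 + d * (2 - d) * (1/2 - x)\<^sup>2"
    unfolding power_mult_distrib p q by (simp add: power2_eq_square field_simps)
  moreover have "d * (2 - d) * (1/2 - x)\<^sup>2 > 0"
    using d x by simp
  ultimately have "(x * (1 - x))\<^sup>2 < (p * q)\<^sup>2" by simp
  then have "x * (1 - x) < p * q"
    by (rule power2_less_imp_less) (simp add: p_def q_def)
  moreover have "(p + q)\<^sup>2 = (1 - x)\<^sup>2 + x\<^sup>2 + 2 * (p * q)"
    unfolding power2_sum p q by (simp add: algebra_simps)
  moreover have "(1 - x)\<^sup>2 + x\<^sup>2 + 2 * (x * (1 - x)) = 1"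
    by (simp add: power2_eq_square algebra_simps)
  ultimately have "1\<^sup>2 < (p + q)\<^sup>2" by simp
  then have "1 < p + q"
    by (rule power2_less_imp_less) (simp add: p_def q_def)
  then show ?thesis by (simp add: p_def q_def)
qed

lemma mean_reflection_not_complex_almost_hadamard:
  assumes card: "CARD('n) \<ge> 3" "CARD('n) \<noteq> 4"
  shows "\<not> complex_almost_hadamard
    (sqrt (real CARD('n)) *\<^sub>R map_matrix complex_of_real (mean_reflection :: real^'n^'n))"
proof -
  let ?x = "2 / real CARD('n)"
  obtain a b :: 'n where ab: "a \<noteq> b"
    using card(1) card_le_Suc0_iff_eq[of "UNIV :: 'n set"] by auto
  have x: "0 < ?x" "?x < 1" "?x \<noteq> 1/2"
    using card by (auto simp: field_simps)
  show ?thesis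
  proof (rule one_norm_less_not_complex_almost_hadamard)
    have "((\<lambda>t. twist a b (cis t)) \<longlongrightarrow> twist a b (cis 0)) (at_right 0)"
      unfolding twist_def
      by (intro tendsto_vec_lambda tendsto_intros tendsto_cis) auto
    then show "((\<lambda>t. twist a b (cis t)) \<longlongrightarrow> map_matrix complex_of_real mean_reflection) (at_right 0)"
      by (simp add: twist_1)
    show "twist a b (cis t) \<in> unitary_group" for t
      by (rule twist_unitary[OF ab]) simp
    \<comment> \<open>Approaching from the right excludes \<open>t = 0\<close>, where the norms
      agree; below \<open>pi / 2\<close> the cosine stays strictly between 0 and 1.\<close>
    have "\<forall>\<^sub>F t in at_right (0::real). t \<in> {0<..<pi / 2}"
      by (rule eventually_at_right_real) simp
    then show "\<forall>\<^sub>F t in at_right 0.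
        one_norm (map_matrix complex_of_real (mean_reflection :: real^'n^'n)) < one_norm (twist a b (cis t))"
    proof eventually_elim
      case (elim t)
      have "cos t < cos 0"
        using elim by (intro cos_monotone_0_pi) auto
      moreover have "0 < cos t"
        using elim by (intro cos_gt_zero) auto
      ultimately show ?case
        using cmod_sum_gt_1[of "cis t" ?x] x
        by (simp add: one_norm_twist[OF ab, of "cis t"] flip: twist_1[of a b])
    qed
  qed simp
qed

theorem theorem4p7:
  fixes U :: "real^'n^'n" and N :: real
  assumes N: "N = real CARD('n)"
    and N_ge: "CARD('n) \<ge> 3"
    and U: "U = (1 / N) *\<^sub>R (2 *\<^sub>R all_ones - N *\<^sub>R mat 1)"
  shows
    "orthogonal_matrix U \<and>
     (\<forall>(B :: real^'n^'n) (lam :: real).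
        transpose B = B \<and> U ** B = lam *\<^sub>R B \<longrightarrow>
        Phi (map_matrix complex_of_real U) (map_matrix complex_of_real B) =
          complex_of_real (lam * ((N - 4) / 2) *
            (trace (B ** B) + (lam * N / (N - 2)) * (\<Sum>i\<in>UNIV. (B $ i $ i)\<^sup>2)))) \<and>
     (CARD('n) \<noteq> 4 \<longrightarrow>
        \<not> complex_almost_hadamard (map_matrix complex_of_real (sqrt N *\<^sub>R U))) \<and>
     (Phi (map_matrix complex_of_real U) (map_matrix complex_of_real all_ones) =
        complex_of_real (N\<^sup>2 * (N - 1) * (N - 4) / (2 * (N - 2))) \<and>
      (CARD('n) = 3 \<longrightarrow>
        Re (Phi (map_matrix complex_of_real U) (map_matrix complex_of_real all_ones)) < 0)) \<and>
     (\<forall>B :: real^'n^'n.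
        B \<noteq> 0 \<and> transpose B = B \<and> B ** all_ones = 0 \<and> (\<forall>i. B $ i $ i = 0) \<longrightarrow>
        Phi (map_matrix complex_of_real U) (map_matrix complex_of_real B) =
          complex_of_real ((2 - N / 2) * trace (B ** B)) \<and>
        (CARD('n) \<ge> 5 \<longrightarrow>
          Re (Phi (map_matrix complex_of_real U) (map_matrix complex_of_real B)) < 0))"
proof -
  have UK: "U = mean_reflection"
    unfolding U N by (rule mean_reflection_eq)
  have "map_matrix complex_of_real (sqrt N *\<^sub>R U) = sqrt N *\<^sub>R map_matrix complex_of_real U"
    by (simp add: vec_eq_iff scaleR_conv_of_real[where 'a = complex])
  then have hadamard: "\<not> complex_almost_hadamard (map_matrix complex_of_real (sqrt N *\<^sub>R U))"
    if "CARD('n) \<noteq> 4"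
    using mean_reflection_not_complex_almost_hadamard[OF N_ge that] by (simp add: UK N)
  \<comment> \<open>The trace is a sum of squares, so a single nonzero entry bounds it away from
    0.\<close>
  have "trace (B ** B) > 0" if "B \<noteq> 0" "transpose B = B" for B :: "real^'n^'n"
  proof -
    obtain i j where ij: "B $ i $ j \<noteq> 0"
      using \<open>B \<noteq> 0\<close> by (auto simp: vec_eq_iff)
    have "0 < (B $ i $ j)\<^sup>2" using ij by simp
    also have "\<dots> \<le> (\<Sum>j\<in>UNIV. (B $ i $ j)\<^sup>2)"
      by (rule member_le_sum) auto
    also have "\<dots> \<le> (\<Sum>i\<in>UNIV. \<Sum>j\<in>UNIV. (B $ i $ j)\<^sup>2)"
      by (rule member_le_sum) (auto intro: sum_nonneg)
    finally show ?thesis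
      using trace_square_symmetric[OF \<open>transpose B = B\<close>] by simp
  qed
  then have neg: "(2 - N / 2) * trace (B ** B) < 0"
    if "B \<noteq> 0" "transpose B = B" "CARD('n) \<ge> 5" for B :: "real^'n^'n"
    using that by (intro mult_neg_pos) (auto simp: N)
  show ?thesis
  proof (intro conjI allI impI)
    show "orthogonal_matrix U"
      unfolding UK by (rule orthogonal_mean_reflection)
    show "Phi (map_matrix complex_of_real U) (map_matrix complex_of_real B) =
        complex_of_real (lam * ((N - 4) / 2) *
          (trace (B ** B) + (lam * N / (N - 2)) * (\<Sum>i\<in>UNIV. (B $ i $ i)\<^sup>2)))"
      if "transpose B = B \<and> U ** B = lam *\<^sub>R B" for B lam
      using that Phi_mean_reflection_eigen[OF N_ge, of B lam] unfolding UK N by blast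
  qed (use N_ge hadamard neg in \<open>auto simp: UK N
      Phi_mean_reflection_all_ones Phi_mean_reflection_zero_diagonal
      simp del: of_real_mult of_real_diff of_real_divide\<close>)
qed

end
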